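(* For all $\varepsilon,\delta\in(0,1)$ there is a $D$ such that for all $d\ge D$, all $\alpha\in(0,1]$, and all integers $$0\le t\le (1-\delta)\,\frac{\log 2}{8\alpha}\,d^2\,2^d,$$ the hypercube shuffling Markov chain on $\mathbb{Z}_2^d$ with move probability $\alpha$ has, after $t$ steps and from a worst starting state, variation distance at least $1-\varepsilon$ from the uniform distribution. This holds both for the chain on arrangements of $2^d$ distinct cards and for the chain on arrangements of $2^{d-1}$ zeros and $2^{d-1}$ ones.
   Context: The hypercube graph has vertex set $\mathbb{Z}_2^d$, two vertices being adjacent when they differ in exactly one coordinate; it has $d2^{d-1}$ edges. Each vertex carries one card: either the $2^d$ cards are all distinct (the state is a bijection between cards and vertices), or there are $2^{d-1}$ cards labeled 0 and $2^{d-1}$ cards labeled 1. At each step, with probability $\alpha$ a uniformly random edge of the hypercube is chosen and the cards at its endpoints are exchanged; with probability $1-\alpha$ nothing happens. The uniform distribution is stationary. Variation distance is total variation distance $\frac12\|\cdot\|_1$. $\log$ is the natural logarithm. *)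

theory Defs
  imports "HOL-Probability.Probability" "HOL-Library.Z2"
begin

definition hypercube :: "nat \<Rightarrow> (nat \<Rightarrow> bit) set" where
  "hypercube d = {..<d} \<rightarrow>\<^sub>E UNIV"

definition hypercube_edges :: "nat \<Rightarrow> (nat \<Rightarrow> bit) set set" where
  "hypercube_edges d =
    {{u, v} | u v. u \<in> hypercube d \<and> v \<in> hypercube d \<and> card {i \<in> {..<d}. u i \<noteq> v i} = 1}"

type_synonym arrangement = "(nat \<Rightarrow> bit) \<Rightarrow> nat"

text \<open>
  An arrangement maps each vertex to the label of the card it carries; it is \<open>undefined\<close> off the
  hypercube, so that arrangements on the cube correspond one-to-one to functions in the logic.
\<close>

definition distinct_arrangements :: "nat \<Rightarrow> arrangement set" where
  "distinct_arrangements d =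
    {\<sigma> \<in> extensional (hypercube d). bij_betw \<sigma> (hypercube d) {..<2 ^ d}}"

definition binary_arrangements :: "nat \<Rightarrow> arrangement set" where
  "binary_arrangements d =
    {\<sigma> \<in> hypercube d \<rightarrow>\<^sub>E {0, 1}.
      card {v \<in> hypercube d. \<sigma> v = 0} = 2 ^ (d - 1) \<and>
      card {v \<in> hypercube d. \<sigma> v = 1} = 2 ^ (d - 1)}"

text \<open>For a two-element edge \<open>e\<close> and \<open>v \<in> e\<close>, \<open>the_elem (e - {v})\<close> is the other endpoint.\<close>

definition exchange :: "(nat \<Rightarrow> bit) set \<Rightarrow> arrangement \<Rightarrow> arrangement" where
  "exchange e \<sigma> = (\<lambda>v. if v \<in> e then \<sigma> (the_elem (e - {v})) else \<sigma> v)"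

definition shuffle_step :: "nat \<Rightarrow> real \<Rightarrow> arrangement \<Rightarrow> arrangement pmf" where
  "shuffle_step d \<alpha> \<sigma> =
    bind_pmf (bernoulli_pmf \<alpha>) (\<lambda>move.
      if move then map_pmf (\<lambda>e. exchange e \<sigma>) (pmf_of_set (hypercube_edges d))
      else return_pmf \<sigma>)"

definition shuffle_dist :: "nat \<Rightarrow> real \<Rightarrow> nat \<Rightarrow> arrangement \<Rightarrow> arrangement pmf" where
  "shuffle_dist d \<alpha> t \<sigma> = ((\<lambda>p. bind_pmf p (shuffle_step d \<alpha>)) ^^ t) (return_pmf \<sigma>)"

definition variation_distance :: "'a pmf \<Rightarrow> 'a pmf \<Rightarrow> real" where
  "variation_distance p q = 1 / 2 * (\<Sum>\<^sub>\<infinity>x. \<bar>pmf p x - pmf q x\<bar>)"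

text \<open>
  \<open>S\<close> is the state space of the chain; it is meant to be finite and nonempty
  (\<open>binary_arrangements 0\<close> is empty, and the cube of dimension 0 has no edges).
\<close>

definition worst_case_distance :: "arrangement set \<Rightarrow> nat \<Rightarrow> real \<Rightarrow> nat \<Rightarrow> real" where
  "worst_case_distance S d \<alpha> t =
    (MAX \<sigma>\<in>S. variation_distance (shuffle_dist d \<alpha> t \<sigma>) (pmf_of_set S))"

end

theory Submission
  imports Defs
begin

text \<open>
  This is Wilson's method. Weight the cards by plus or minus one, and let \<open>\<Phi>\<close> be the sum of the weights,
  each multiplied by the sign of the side of the cube (split along coordinate 0) on which the card
  lies. With \<open>\<gamma> = 4 \<alpha> / (d 2\<^sup>d)\<close>, one step multiplies the mean of \<open>\<Phi>\<close> by \<open>1 - \<gamma>\<close>, and the expected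
  squared increment is at most \<open>R = 16 \<alpha> / d\<close>, because only a \<open>1 / d\<close> fraction of the edges changes
  \<open>\<Phi>\<close>, each by at most 4. Hence the variance of \<open>\<Phi>\<close> stays below \<open>R / (2 \<gamma>) = 2 \<cdot> 2\<^sup>d\<close> both along
  the chain and in equilibrium. Started from its maximum \<open>2\<^sup>d\<close>, the mean of \<open>\<Phi>\<close> exceeds this standard
  deviation until time about \<open>d ln 2 / (2 \<gamma>)\<close>, and Chebyshev's inequality separates the two laws.
\<close>

section \<open>Distinguishing statistics\<close>

text \<open>Off the finite union \<open>B\<close> of the two supports nothing contributes to the
  sum. On \<open>B\<close>, \<bar>p - q\<bar> is at least p - q inside \<open>A\<close> and at least
  q - p outside. Since both laws have mass 1, each part yields the same gap, and the two gaps cancel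
  the factor 1/2.\<close>

lemma variation_distance_ge_measure_diff:
  assumes "finite (set_pmf p)" "finite (set_pmf q)"
  shows "variation_distance p q \<ge> measure_pmf.prob p A - measure_pmf.prob q A"
proof -
  define B where "B = set_pmf p \<union> set_pmf q"
  have fin: "finite B" using assms by (simp add: B_def)
  have prob_eq: "measure_pmf.prob r X = (\<Sum>x\<in>B \<inter> X. pmf r x)" if "set_pmf r \<subseteq> B" for r X
  proof -
    have "measure_pmf.prob r X = measure_pmf.prob r (B \<inter> X)"
      using that by (intro measure_eq_AE) (auto simp: AE_measure_pmf_iff)
    then show ?thesis using fin by (simp add: measure_measure_pmf_finite)
  qed
  have p: "set_pmf p \<subseteq> B" and q: "set_pmf q \<subseteq> B" by (auto simp: B_def)
  have "(\<Sum>\<^sub>\<infinity>x. \<bar>pmf p x - pmf q x\<bar>) = (\<Sum>\<^sub>\<infinity>x\<in>B. \<bar>pmf p x - pmf q x\<bar>)"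
    by (rule infsum_cong_neutral) (auto simp: B_def set_pmf_iff)
  also have "\<dots> = (\<Sum>x\<in>B. \<bar>pmf p x - pmf q x\<bar>)" using fin by simp
  also have "\<dots> = (\<Sum>x\<in>B \<inter> A. \<bar>pmf p x - pmf q x\<bar>) + (\<Sum>x\<in>B \<inter> - A. \<bar>pmf p x - pmf q x\<bar>)"
    using sum.Int_Diff[OF fin, of _ A] by (simp add: Diff_eq)
  also have "\<dots> \<ge> (\<Sum>x\<in>B \<inter> A. pmf p x - pmf q x) + (\<Sum>x\<in>B \<inter> - A. pmf q x - pmf p x)"
    by (intro add_mono sum_mono) auto
  also have "(\<Sum>x\<in>B \<inter> A. pmf p x - pmf q x) + (\<Sum>x\<in>B \<inter> - A. pmf q x - pmf p x) =
      2 * (measure_pmf.prob p A - measure_pmf.prob q A)"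
    using measure_pmf.prob_compl[of A p] measure_pmf.prob_compl[of A q]
    by (simp add: sum_subtractf prob_eq[OF p, symmetric] prob_eq[OF q, symmetric] Compl_eq_Diff_UNIV)
  finally show ?thesis by (simp add: variation_distance_def)
qed

lemma variation_distance_ge_of_moments:
  fixes f :: "'a \<Rightarrow> real"
  assumes fin: "finite (set_pmf p)" "finite (set_pmf q)"
    and gap: "measure_pmf.expectation p f - measure_pmf.expectation q f = 2 * r" "r > 0"
    and var: "measure_pmf.variance p f \<le> V" "measure_pmf.variance q f \<le> V"
  shows "variation_distance p q \<ge> 1 - 2 * V / r\<^sup>2"
proof -
  \<comment> \<open>The threshold is midway between the means, as it also equals the mean under
    \<open>p\<close> minus \<open>r\<close>. So each law puts mass at most V / r^2 on the wrong
    side.\<close>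
  define A where "A = {x. f x > measure_pmf.expectation q f + r}"
  have chebyshev: "measure_pmf.prob s {x. r \<le> \<bar>f x - measure_pmf.expectation s f\<bar>} \<le> V / r\<^sup>2"
    if "finite (set_pmf s)" "measure_pmf.variance s f \<le> V" for s
  proof -
    have "measure_pmf.prob s {x \<in> space (measure_pmf s). r \<le> \<bar>f x - measure_pmf.expectation s f\<bar>}
        \<le> measure_pmf.variance s f / r\<^sup>2"
      using that gap by (intro measure_pmf.Chebyshev_inequality) (auto intro: integrable_measure_pmf_finite)
    also have "\<dots> \<le> V / r\<^sup>2" using that by (intro divide_right_mono) auto
    finally show ?thesis by simp
  qed
  have "measure_pmf.prob q A \<le> V / r\<^sup>2"
    by (rule order.trans[OF measure_pmf.finite_measure_mono chebyshev[OF fin(2) var(2)]])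
       (auto simp: A_def)
  moreover have "measure_pmf.prob p (- A) \<le> V / r\<^sup>2"
    by (rule order.trans[OF measure_pmf.finite_measure_mono chebyshev[OF fin(1) var(1)]])
       (use gap in \<open>auto simp: A_def\<close>)
  ultimately have "measure_pmf.prob p A - measure_pmf.prob q A \<ge> 1 - 2 * V / r\<^sup>2"
    using measure_pmf.prob_compl[of A p] by (simp add: Compl_eq_Diff_UNIV)
  then show ?thesis using variation_distance_ge_measure_diff[OF fin, of A] by linarith
qed

section \<open>Wilson's method\<close>

text \<open>Given \<open>eigen\<close>, the condition \<open>square\<close> says exactly that the
  expected squared increment of \<Phi> in one step is at most \<open>R\<close>: expand (\<Phi> y -
  \<Phi> x)^2. The bound \<gamma> \<le> 1/2 keeps 1 - 2 * \<gamma> nonnegative, so that the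
  inequality can be iterated.\<close>

locale approximate_eigenfunction =
  fixes K :: "'a \<Rightarrow> 'a pmf" and S :: "'a set" and \<Phi> :: "'a \<Rightarrow> real" and \<gamma> R :: real
  assumes finite_states: "finite S"
    and closed: "x \<in> S \<Longrightarrow> set_pmf (K x) \<subseteq> S"
    and eigen: "x \<in> S \<Longrightarrow> measure_pmf.expectation (K x) \<Phi> = (1 - \<gamma>) * \<Phi> x"
    and square: "x \<in> S \<Longrightarrow>
      measure_pmf.expectation (K x) (\<lambda>y. (\<Phi> y)\<^sup>2) \<le> (1 - 2 * \<gamma>) * (\<Phi> x)\<^sup>2 + R"
    and rate: "0 < \<gamma>" "\<gamma> \<le> 1 / 2"
begin

lemma expectation_step:
  fixes f :: "'a \<Rightarrow> real"
  assumes "set_pmf p \<subseteq> S"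
  shows "measure_pmf.expectation (bind_pmf p K) f =
    measure_pmf.expectation p (\<lambda>x. measure_pmf.expectation (K x) f)"
proof -
  have "measure_pmf.expectation (bind_pmf p K) f =
      (\<Sum>a\<in>S. pmf p a *\<^sub>R measure_pmf.expectation (K a) f)"
    using finite_states closed assms by (intro pmf_expectation_bind) (auto intro: finite_subset)
  also have "\<dots> = measure_pmf.expectation p (\<lambda>x. measure_pmf.expectation (K x) f)"
    by (rule integral_measure_pmf[symmetric]) (use finite_states assms in auto)
  finally show ?thesis .
qed

lemma mean_step:
  assumes "set_pmf p \<subseteq> S"
  shows "measure_pmf.expectation (bind_pmf p K) \<Phi> = (1 - \<gamma>) * measure_pmf.expectation p \<Phi>"
proof -
  have "measure_pmf.expectation p (\<lambda>x. measure_pmf.expectation (K x) \<Phi>) =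
      measure_pmf.expectation p (\<lambda>x. (1 - \<gamma>) * \<Phi> x)"
    using assms eigen by (intro integral_cong_AE) (auto simp: AE_measure_pmf_iff)
  then show ?thesis by (simp add: expectation_step[OF assms])
qed

lemma square_step:
  assumes "set_pmf p \<subseteq> S"
  shows "measure_pmf.expectation (bind_pmf p K) (\<lambda>x. (\<Phi> x)\<^sup>2) \<le>
    (1 - 2 * \<gamma>) * measure_pmf.expectation p (\<lambda>x. (\<Phi> x)\<^sup>2) + R"
proof -
  have int: "integrable (measure_pmf p) f" for f :: "'a \<Rightarrow> real"
    using assms finite_states by (intro integrable_measure_pmf_finite) (auto intro: finite_subset)
  have "measure_pmf.expectation p (\<lambda>x. measure_pmf.expectation (K x) (\<lambda>x. (\<Phi> x)\<^sup>2)) \<le>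
      measure_pmf.expectation p (\<lambda>x. (1 - 2 * \<gamma>) * (\<Phi> x)\<^sup>2 + R)"
    using assms square by (intro integral_mono_AE int) (auto simp: AE_measure_pmf_iff)
  also have "\<dots> = (1 - 2 * \<gamma>) * measure_pmf.expectation p (\<lambda>x. (\<Phi> x)\<^sup>2) + R"
    by (subst Bochner_Integration.integral_add) (auto intro: int)
  finally show ?thesis by (simp add: expectation_step[OF assms])
qed

lemma iterate_closed:
  assumes "set_pmf p \<subseteq> S"
  shows "set_pmf (((\<lambda>p. bind_pmf p K) ^^ t) p) \<subseteq> S"
  using assms closed by (induction t) auto

lemma mean_iterate:
  assumes "set_pmf p \<subseteq> S"
  shows "measure_pmf.expectation (((\<lambda>p. bind_pmf p K) ^^ t) p) \<Phi> =
    (1 - \<gamma>) ^ t * measure_pmf.expectation p \<Phi>"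
  by (induction t) (simp_all add: mean_step iterate_closed assms)

text \<open>R / (2 * \<gamma>) is the fixed point of the affine map m -> (1 - 2 * \<gamma>) * m + R,
  so the excess over it shrinks by the factor 1 - 2 * \<gamma> in each step.\<close>

lemma square_iterate:
  assumes "set_pmf p \<subseteq> S"
  shows "measure_pmf.expectation (((\<lambda>p. bind_pmf p K) ^^ t) p) (\<lambda>x. (\<Phi> x)\<^sup>2) - R / (2 * \<gamma>) \<le>
    (1 - 2 * \<gamma>) ^ t * (measure_pmf.expectation p (\<lambda>x. (\<Phi> x)\<^sup>2) - R / (2 * \<gamma>))"
proof (induction t)
  case (Suc t)
  define c where "c = R / (2 * \<gamma>)"
  then have R: "R = 2 * \<gamma> * c" using rate by simp
  have "measure_pmf.expectation (((\<lambda>p. bind_pmf p K) ^^ Suc t) p) (\<lambda>x. (\<Phi> x)\<^sup>2) - R / (2 * \<gamma>) \<le>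
      (1 - 2 * \<gamma>) * (measure_pmf.expectation (((\<lambda>p. bind_pmf p K) ^^ t) p) (\<lambda>x. (\<Phi> x)\<^sup>2)
        - R / (2 * \<gamma>))"
    using square_step[OF iterate_closed[OF assms, of t]] unfolding c_def[symmetric]
    by (simp add: R algebra_simps)
  also have "\<dots> \<le> (1 - 2 * \<gamma>) *
      ((1 - 2 * \<gamma>) ^ t * (measure_pmf.expectation p (\<lambda>x. (\<Phi> x)\<^sup>2) - R / (2 * \<gamma>)))"
    using rate by (intro mult_left_mono Suc) auto
  finally show ?case by (simp add: mult_ac)
qed simp

text \<open>From a deterministic start the second moment is at most (1 - 2 * \<gamma>)^t * (\<Phi>
  x)^2 + R / (2 * \<gamma>). As 1 - 2 * \<gamma> \<le> (1 - \<gamma>)^2, its first term is at most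
  the squared mean, and subtracting the latter leaves a bound uniform in \<open>t\<close>.\<close>

lemma variance_iterate:
  assumes "x \<in> S" "0 \<le> R"
  shows "measure_pmf.variance (((\<lambda>p. bind_pmf p K) ^^ t) (return_pmf x)) \<Phi> \<le> R / (2 * \<gamma>)"
proof -
  let ?p = "((\<lambda>p. bind_pmf p K) ^^ t) (return_pmf x)"
  have x: "set_pmf (return_pmf x) \<subseteq> S" using assms by simp
  have int: "integrable (measure_pmf ?p) f" for f :: "'a \<Rightarrow> real"
    using iterate_closed[OF x] finite_states
    by (intro integrable_measure_pmf_finite) (rule finite_subset)
  have "(1 - 2 * \<gamma>) ^ t \<le> ((1 - \<gamma>)\<^sup>2) ^ t"
    using rate by (intro power_mono) (auto simp: power2_eq_square algebra_simps)
  then have decay: "(1 - 2 * \<gamma>) ^ t * (\<Phi> x)\<^sup>2 \<le> ((1 - \<gamma>) ^ t * \<Phi> x)\<^sup>2"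
    unfolding power_mult_distrib by (intro mult_right_mono) (auto simp: power_mult[symmetric] mult.commute)
  have "0 \<le> (1 - 2 * \<gamma>) ^ t * (R / (2 * \<gamma>))" using rate assms by simp
  with square_iterate[OF x, of t] decay
  have "measure_pmf.expectation ?p (\<lambda>x. (\<Phi> x)\<^sup>2) \<le> ((1 - \<gamma>) ^ t * \<Phi> x)\<^sup>2 + R / (2 * \<gamma>)"
    by (simp add: right_diff_distrib)
  then show ?thesis
    by (subst measure_pmf.variance_eq) (simp_all add: int mean_iterate[OF x])
qed

lemma wilson_lower_bound:
  assumes x: "x \<in> S" "0 < \<Phi> x" and "0 \<le> R"
    and stationary: "bind_pmf \<pi> K = \<pi>" "set_pmf \<pi> \<subseteq> S"
  shows "variation_distance (((\<lambda>p. bind_pmf p K) ^^ t) (return_pmf x)) \<pi> \<ge>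
    1 - 4 * R / (\<gamma> * ((1 - \<gamma>) ^ t * \<Phi> x)\<^sup>2)"
proof -
  let ?p = "((\<lambda>p. bind_pmf p K) ^^ t) (return_pmf x)"
  have sx: "set_pmf (return_pmf x) \<subseteq> S" using x by simp
  have fin: "finite (set_pmf ?p)" "finite (set_pmf \<pi>)"
    using iterate_closed[OF sx] stationary finite_states by (auto intro: finite_subset)
  have int: "integrable (measure_pmf \<pi>) f" for f :: "'a \<Rightarrow> real"
    using fin by (intro integrable_measure_pmf_finite)
  \<comment> \<open>Stationarity turns both one-step relations into bounds on \<open>\<pi>\<close>:
    the mean m satisfies m = (1 - \<gamma>) * m, hence vanishes, and the second moment is then the
    variance.\<close>
  have mean: "measure_pmf.expectation \<pi> \<Phi> = 0"
    using mean_step[OF stationary(2)] rate by (simp add: stationary algebra_simps)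
  have var: "measure_pmf.variance \<pi> \<Phi> \<le> R / (2 * \<gamma>)"
    using square_step[OF stationary(2)] rate
    by (simp add: stationary measure_pmf.variance_eq int mean field_simps)
  define r where "r = (1 - \<gamma>) ^ t * \<Phi> x / 2"
  have "1 - 2 * (R / (2 * \<gamma>)) / r\<^sup>2 \<le> variation_distance ?p \<pi>"
  proof (rule variation_distance_ge_of_moments[OF fin _ _ variance_iterate[OF x(1) \<open>0 \<le> R\<close>] var])
    show "measure_pmf.expectation ?p \<Phi> - measure_pmf.expectation \<pi> \<Phi> = 2 * r"
      by (simp add: mean mean_iterate[OF sx] r_def)
    show "0 < r" using rate x by (simp add: r_def)
  qed
  also have "2 * (R / (2 * \<gamma>)) / r\<^sup>2 = 4 * R / (\<gamma> * ((1 - \<gamma>) ^ t * \<Phi> x)\<^sup>2)"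
    using rate by (simp add: r_def power_divide)
  finally show ?thesis .
qed

end

section \<open>The hypercube\<close>

text \<open>Addition in \<open>bit\<close> is modulo 2, so adding 1 toggles a coordinate. Vertices
  are \<open>undefined\<close> beyond coordinate \<open>d\<close>, so only the directions i < d stay
  in the cube.\<close>

definition flip :: "nat \<Rightarrow> (nat \<Rightarrow> bit) \<Rightarrow> nat \<Rightarrow> bit" where
  "flip i v = v(i := v i + 1)"

lemma flip_flip [simp]: "flip i (flip i v) = v"
  by (rule ext) (simp add: flip_def add.assoc)

lemma flip_at [simp]: "flip i v i = v i + 1"
  by (simp add: flip_def)

lemma flip_other [simp]: "j \<noteq> i \<Longrightarrow> flip i v j = v j"
  by (simp add: flip_def)

lemma flip_neq [simp]: "flip i v \<noteq> v" "v \<noteq> flip i v"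
  by (metis flip_at add_cancel_right_right zero_neq_one)+

lemma flip_in_hypercube [simp]: "i < d \<Longrightarrow> flip i v \<in> hypercube d \<longleftrightarrow> v \<in> hypercube d"
  by (auto simp: hypercube_def flip_def PiE_iff extensional_def)

lemma UNIV_bit: "(UNIV :: bit set) = {0, 1}"
  using bit_not_one_iff by blast

lemma finite_hypercube [simp]: "finite (hypercube d)"
  by (simp add: hypercube_def finite_PiE UNIV_bit)

lemma card_hypercube [simp]: "card (hypercube d) = 2 ^ d"
  by (simp add: hypercube_def card_PiE UNIV_bit numeral_2_eq_2)

lemma sum_flip:
  assumes "i < d"
  shows "(\<Sum>v\<in>hypercube d. f (flip i v)) = sum f (hypercube d)"
  using assms by (intro sum.reindex_bij_witness[of _ "flip i" "flip i"]) auto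

text \<open>\<open>flip i\<close> matches the half-cube v i = 0 with the opposite half.\<close>

lemma sum_hypercube_split:
  fixes f :: "(nat \<Rightarrow> bit) \<Rightarrow> 'b::comm_monoid_add"
  assumes "i < d"
  shows "sum f (hypercube d) = (\<Sum>v\<in>{v \<in> hypercube d. v i = 0}. f v + f (flip i v))"
proof -
  have "sum f (hypercube d) =
      sum f {v \<in> hypercube d. v i = 0} + sum f {v \<in> hypercube d. v i \<noteq> 0}"
    using sum.Int_Diff[OF finite_hypercube, of f d "{v. v i = 0}"] by (simp add: Int_def set_diff_eq)
  also have "sum f {v \<in> hypercube d. v i \<noteq> 0} = (\<Sum>v\<in>{v \<in> hypercube d. v i = 0}. f (flip i v))"
    using assms by (intro sum.reindex_bij_witness[of _ "flip i" "flip i"]) auto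
  finally show ?thesis by (simp add: sum.distrib)
qed

lemma card_hypercube_halves:
  assumes "i < d"
  shows "card {v \<in> hypercube d. v i = 0} = 2 ^ (d - 1)"
    and "card {v \<in> hypercube d. v i \<noteq> 0} = 2 ^ (d - 1)"
proof -
  have "2 ^ d = 2 * card {v \<in> hypercube d. v i = 0}"
    using sum_hypercube_split[OF assms, of "\<lambda>_. 1::nat"] by simp
  then show half: "card {v \<in> hypercube d. v i = 0} = 2 ^ (d - 1)"
    using assms by (cases d) auto
  have "card {v \<in> hypercube d. v i \<noteq> 0} = card {v \<in> hypercube d. v i = 0}"
    using assms by (intro bij_betw_same_card[of "flip i"] bij_betw_byWitness[where f' = "flip i"]) auto
  then show "card {v \<in> hypercube d. v i \<noteq> 0} = 2 ^ (d - 1)" by (simp add: half)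
qed

section \<open>Parametrization and counting of the edges\<close>

text \<open>An edge is given by its direction and its endpoint with coordinate 0 in that direction.
  This choice of endpoint makes the parametrization injective.\<close>

lemma hypercube_edges_eq:
  "hypercube_edges d = (\<lambda>(i, v). {v, flip i v}) ` (SIGMA i:{..<d}. {v \<in> hypercube d. v i = 0})"
  (is "_ = ?g ` ?P")
proof (intro equalityI subsetI)
  fix e assume "e \<in> hypercube_edges d"
  then obtain u v where e: "e = {u, v}" and uv: "u \<in> hypercube d" "v \<in> hypercube d"
    and card: "card {i \<in> {..<d}. u i \<noteq> v i} = 1" by (auto simp: hypercube_edges_def)
  from card obtain i where i: "{i \<in> {..<d}. u i \<noteq> v i} = {i}" by (rule card_1_singletonE)
  then have id: "i < d" and neq: "u i \<noteq> v i" by auto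
  \<comment> \<open>Unequal bits differ by 1, which settles coordinate \<open>i\<close>. Other
    coordinates below \<open>d\<close> agree by the choice of \<open>i\<close>, and those from
    \<open>d\<close> on are \<open>undefined\<close> for both vertices.\<close>
  have v: "v = flip i u"
  proof
    fix j
    show "v j = flip i u j"
    proof (cases "j = i")
      case True
      with neq show ?thesis by (cases "u i"; cases "v i") auto
    next
      case False
      then have "u j = v j" if "j < d" using i that by auto
      moreover have "u j = v j" if "\<not> j < d"
        using uv that by (simp add: hypercube_def PiE_iff extensional_def)
      ultimately have "u j = v j" by blast
      then show ?thesis using False by simp
    qed
  qed
  show "e \<in> ?g ` ?P"
  proof (cases "u i = 0")
    case True
    then have "(i, u) \<in> ?P" using uv id by simp
    moreover have "e = ?g (i, u)" by (simp add: e v)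
    ultimately show ?thesis by (rule rev_image_eqI)
  next
    case False
    then have "v i = 0" using neq by simp
    then have "(i, v) \<in> ?P" using uv id by simp
    moreover have "e = ?g (i, v)" by (simp add: e v doubleton_eq_iff)
    ultimately show ?thesis by (rule rev_image_eqI)
  qed
next
  fix e assume "e \<in> ?g ` ?P"
  then obtain i v where iv: "i < d" "v \<in> hypercube d" "e = {v, flip i v}" by auto
  have single: "{j \<in> {..<d}. v j \<noteq> flip i v j} = {i}" using iv by (auto simp: flip_def)
  have "card {j \<in> {..<d}. v j \<noteq> flip i v j} = 1" unfolding single by simp
  moreover have "flip i v \<in> hypercube d" using iv by simp
  ultimately show "e \<in> hypercube_edges d"
    unfolding hypercube_edges_def mem_Collect_eq using iv
    by - (rule exI[of _ v], rule exI[of _ "flip i v"], intro conjI)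
qed

lemma hypercube_edgeE:
  assumes "e \<in> hypercube_edges d"
  obtains i v where "i < d" "v \<in> hypercube d" "e = {v, flip i v}"
  using assms by (auto simp: hypercube_edges_eq)

lemma finite_hypercube_edges [simp]: "finite (hypercube_edges d)"
  by (simp add: hypercube_edges_eq)

lemma inj_on_hypercube_edge:
  "inj_on (\<lambda>(i, v). {v, flip i v}) (SIGMA i:{..<d}. {v \<in> hypercube d. v i = 0})"
proof (rule inj_onI, clarsimp)
  fix i v j w
  assume vi: "v i = 0" and wj: "w j = 0" and eq: "{v, flip i v} = {w, flip j w}"
  \<comment> \<open>The endpoints cannot match crosswise: \<open>v\<close> would have 1 and
    \<open>flip i v\<close> would have 0 in coordinate \<open>j\<close>, forcing i = j and so v i =
    1.\<close>
  have "\<not> (v = flip j w \<and> flip i v = w)"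
  proof
    assume "v = flip j w \<and> flip i v = w"
    then have "v j = 1" "flip i v j = 0" using wj by auto
    then show False using vi by (cases "i = j") auto
  qed
  with eq have *: "v = w" "flip i v = flip j v" by (auto simp: doubleton_eq_iff)
  then have "i = j" by (metis flip_at flip_other add_cancel_right_right zero_neq_one)
  with * show "i = j \<and> v = w" by simp
qed

text \<open>Summing over all pairs of a direction and a vertex counts each edge twice.\<close>

lemma sum_hypercube_edges:
  fixes f :: "(nat \<Rightarrow> bit) set \<Rightarrow> real"
  shows "sum f (hypercube_edges d) = (\<Sum>i<d. \<Sum>v\<in>hypercube d. f {v, flip i v}) / 2"
proof -
  have "sum f (hypercube_edges d) = (\<Sum>i<d. \<Sum>v\<in>{v \<in> hypercube d. v i = 0}. f {v, flip i v})"
    unfolding hypercube_edges_eq sum.reindex[OF inj_on_hypercube_edge]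
    by (subst sum.Sigma) (auto intro!: sum.cong)
  also have "\<dots> = (\<Sum>i<d. (\<Sum>v\<in>hypercube d. f {v, flip i v}) / 2)"
    by (intro sum.cong refl) (simp add: sum_hypercube_split insert_commute sum_distrib_left[symmetric])
  finally show ?thesis by (simp add: sum_divide_distrib)
qed

lemma card_hypercube_edges: "real (card (hypercube_edges d)) = real d * 2 ^ d / 2"
  using sum_hypercube_edges[of "\<lambda>_. 1" d] by simp

lemma hypercube_edges_nonempty: "0 < d \<Longrightarrow> hypercube_edges d \<noteq> {}"
  using card_hypercube_edges[of d] by auto

section \<open>The statistic of the shuffle\<close>

text \<open>Precomposition with a transposition makes it plain that an exchange is an involution and
  permutes the cards.\<close>

lemma exchange_eq_transpose: "v \<noteq> w \<Longrightarrow> exchange {v, w} \<sigma> = \<sigma> \<circ> Transposition.transpose v w"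
  by (rule ext) (auto simp: exchange_def Transposition.transpose_def insert_Diff_if)

text \<open>The character (-1)^(v 0) of the cube; among all flips only those in direction 0 change
  it.\<close>

definition side :: "(nat \<Rightarrow> bit) \<Rightarrow> real" where
  "side v = (if v 0 = 0 then 1 else - 1)"

lemma side_flip: "side (flip i v) = (if i = 0 then - side v else side v)"
  by (auto simp: side_def flip_def)

lemma side_square: "side v * side v = 1"
  by (simp add: side_def)

text \<open>The weights \<open>w\<close> are a parameter, so one statistic serves both distinct and
  binary cards.\<close>

definition imbalance :: "nat \<Rightarrow> (nat \<Rightarrow> real) \<Rightarrow> arrangement \<Rightarrow> real" where
  "imbalance d w \<sigma> = (\<Sum>v\<in>hypercube d. side v * w (\<sigma> v))"

lemma imbalance_exchange:
  assumes "i < d" "v \<in> hypercube d"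
  shows "imbalance d w (exchange {v, flip i v} \<sigma>) = imbalance d w \<sigma> +
    (if i = 0 then 2 * side v * (w (\<sigma> (flip i v)) - w (\<sigma> v)) else 0)"
proof -
  let ?\<tau> = "exchange {v, flip i v} \<sigma>"
  have "imbalance d w ?\<tau> - imbalance d w \<sigma> = (\<Sum>u\<in>hypercube d. side u * (w (?\<tau> u) - w (\<sigma> u)))"
    by (simp add: imbalance_def sum_subtractf right_diff_distrib)
  \<comment> \<open>All other vertices keep their cards.\<close>
  also have "\<dots> = (\<Sum>u\<in>{v, flip i v}. side u * (w (?\<tau> u) - w (\<sigma> u)))"
    using assms by (intro sum.mono_neutral_right) (auto simp: exchange_def)
  also have "\<dots> = (side v - side (flip i v)) * (w (\<sigma> (flip i v)) - w (\<sigma> v))"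
    by (simp add: exchange_eq_transpose algebra_simps)
  finally show ?thesis by (cases "i = 0") (simp_all add: side_flip algebra_simps)
qed

text \<open>Only direction 0 contributes. There, summing over vertices, the incoming cards give -2
  times the imbalance, since \<open>flip 0\<close> reverses the side, and the outgoing cards give
  another -2. Every edge was counted twice, so half of -4 remains.\<close>

lemma sum_imbalance_exchange:
  assumes "0 < d"
  shows "(\<Sum>e\<in>hypercube_edges d. imbalance d w (exchange e \<sigma>) - imbalance d w \<sigma>) =
    - 2 * imbalance d w \<sigma>"
proof -
  have "(\<Sum>e\<in>hypercube_edges d. imbalance d w (exchange e \<sigma>) - imbalance d w \<sigma>) =
      (\<Sum>i<d. \<Sum>v\<in>hypercube d.
        if i = 0 then 2 * side v * (w (\<sigma> (flip i v)) - w (\<sigma> v)) else 0) / 2"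
    unfolding sum_hypercube_edges
    by (intro arg_cong[where f = "\<lambda>x. x / 2"] sum.cong refl) (auto simp: imbalance_exchange)
  also have "(\<Sum>i<d. \<Sum>v\<in>hypercube d.
        if i = 0 then 2 * side v * (w (\<sigma> (flip i v)) - w (\<sigma> v)) else 0) =
      (\<Sum>v\<in>hypercube d. 2 * side v * (w (\<sigma> (flip 0 v)) - w (\<sigma> v)))"
    using assms by (subst sum.remove[of _ 0]) auto
  also have "\<dots> = (\<Sum>v\<in>hypercube d. - (2 * (side (flip 0 v) * w (\<sigma> (flip 0 v))))) -
      (\<Sum>v\<in>hypercube d. 2 * (side v * w (\<sigma> v)))"
    by (simp add: sum_subtractf[symmetric] side_flip algebra_simps)
  also have "\<dots> = - 4 * imbalance d w \<sigma>"
    unfolding imbalance_def sum_flip[OF assms, of "\<lambda>v. - (2 * (side v * w (\<sigma> v)))"]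
    by (simp add: sum_negf sum_distrib_left[symmetric])
  finally show ?thesis by simp
qed

text \<open>The 2^(d - 1) edges in direction 0 each change the imbalance by at most 4, and no other
  edge changes it.\<close>

lemma sum_imbalance_exchange_square:
  assumes "0 < d" and w: "\<And>c. \<bar>w c\<bar> \<le> 1"
  shows "(\<Sum>e\<in>hypercube_edges d. (imbalance d w (exchange e \<sigma>) - imbalance d w \<sigma>)\<^sup>2) \<le> 8 * 2 ^ d"
proof -
  have "(\<Sum>e\<in>hypercube_edges d. (imbalance d w (exchange e \<sigma>) - imbalance d w \<sigma>)\<^sup>2) \<le>
      (\<Sum>i<d. \<Sum>v\<in>hypercube d. if i = 0 then 16 else 0) / 2"
    unfolding sum_hypercube_edges
  proof (intro divide_right_mono sum_mono)
    fix i v assume iv: "i \<in> {..<d}" "v \<in> hypercube d"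
    have "\<bar>w (\<sigma> (flip i v)) - w (\<sigma> v)\<bar> \<le> 2"
      using w[of "\<sigma> (flip i v)"] w[of "\<sigma> v"] by linarith
    then have "(w (\<sigma> (flip i v)) - w (\<sigma> v))\<^sup>2 \<le> 2\<^sup>2"
      by (rule power2_le_iff_abs_le[THEN iffD2, rotated]) simp
    then show "(imbalance d w (exchange {v, flip i v} \<sigma>) - imbalance d w \<sigma>)\<^sup>2 \<le>
        (if i = 0 then 16 else 0)"
      using iv by (cases "i = 0") 
        (simp_all add: imbalance_exchange power_mult_distrib
          power2_eq_square[of "side v"] side_square)
  qed simp
  also have "(\<Sum>i<d. \<Sum>v\<in>hypercube d. if i = 0 then 16 else 0 :: real) = 16 * 2 ^ d"
    using assms by (subst sum.remove[of _ 0]) auto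
  finally show ?thesis by simp
qed

lemma expectation_shuffle_step:
  fixes f :: "arrangement \<Rightarrow> real"
  assumes "0 < d" "0 \<le> \<alpha>" "\<alpha> \<le> 1"
  shows "measure_pmf.expectation (shuffle_step d \<alpha> \<sigma>) f =
    f \<sigma> + \<alpha> * (\<Sum>e\<in>hypercube_edges d. f (exchange e \<sigma>) - f \<sigma>) / card (hypercube_edges d)"
proof -
  let ?E = "hypercube_edges d"
  have E: "?E \<noteq> {}" "finite ?E" using assms hypercube_edges_nonempty by auto
  then have "card ?E \<noteq> 0" by simp
  have "measure_pmf.expectation (shuffle_step d \<alpha> \<sigma>) f =
      \<alpha> * ((\<Sum>e\<in>?E. f (exchange e \<sigma>)) / card ?E) + (1 - \<alpha>) * f \<sigma>"
    unfolding shuffle_step_def using assms E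
    by (subst pmf_expectation_bind[where A = UNIV])
       (auto simp: UNIV_bool integral_pmf_of_set)
  then show ?thesis using \<open>card ?E \<noteq> 0\<close> by (simp add: sum_subtractf field_simps)
qed

section \<open>Spaces of arrangements\<close>

text \<open>The features common to both chains. Closure under transpositions makes every exchange a
  permutation of \<open>S\<close>; the start aligns the weights with the sides, which gives the
  imbalance its largest value 2^d.\<close>

locale arrangement_space =
  fixes d :: nat and S :: "arrangement set" and w :: "nat \<Rightarrow> real" and \<sigma>\<^sub>0 :: arrangement
  assumes dim_pos: "0 < d"
    and finite_space: "finite S"
    and transpose_closed: "\<lbrakk>\<sigma> \<in> S; u \<in> hypercube d; v \<in> hypercube d\<rbrakk> \<Longrightarrow>
      \<sigma> \<circ> Transposition.transpose u v \<in> S"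
    and weight: "\<bar>w c\<bar> \<le> 1"
    and start: "\<sigma>\<^sub>0 \<in> S" "v \<in> hypercube d \<Longrightarrow> w (\<sigma>\<^sub>0 v) = side v"
begin

lemma exchange_closed: "\<lbrakk>\<sigma> \<in> S; e \<in> hypercube_edges d\<rbrakk> \<Longrightarrow> exchange e \<sigma> \<in> S"
  by (erule hypercube_edgeE) (simp add: exchange_eq_transpose transpose_closed)

lemma shuffle_step_closed: "\<sigma> \<in> S \<Longrightarrow> set_pmf (shuffle_step d \<alpha> \<sigma>) \<subseteq> S"
  by (auto simp: shuffle_step_def exchange_closed
      set_pmf_of_set[OF hypercube_edges_nonempty[OF dim_pos] finite_hypercube_edges] split: if_splits)

lemma map_exchange_uniform:
  assumes "e \<in> hypercube_edges d"
  shows "map_pmf (exchange e) (pmf_of_set S) = pmf_of_set S"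
proof (rule map_pmf_of_set_bij_betw)
  have "exchange e (exchange e \<sigma>) = \<sigma>" for \<sigma>
    using assms by (auto elim!: hypercube_edgeE simp: exchange_eq_transpose comp_assoc)
  then show "bij_betw (exchange e) S S"
    using exchange_closed[OF _ assms] by (intro bij_betw_byWitness[where f' = "exchange e"]) auto
qed (use start finite_space in auto)

text \<open>Drawing the coin and the edge before the state, each step is a fixed permutation of
  \<open>S\<close>, which preserves the uniform law.\<close>

lemma uniform_stationary: "bind_pmf (pmf_of_set S) (shuffle_step d \<alpha>) = pmf_of_set S"
proof -
  let ?\<pi> = "pmf_of_set S" and ?E = "pmf_of_set (hypercube_edges d)"
  have "bind_pmf ?\<pi> (\<lambda>\<sigma>. map_pmf (\<lambda>e. exchange e \<sigma>) ?E) = bind_pmf ?E (\<lambda>e. map_pmf (exchange e) ?\<pi>)"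
    unfolding map_pmf_def by (rule bind_commute_pmf)
  also have "\<dots> = bind_pmf ?E (\<lambda>e. ?\<pi>)"
    using hypercube_edges_nonempty[OF dim_pos] by (intro bind_pmf_cong) (auto simp: map_exchange_uniform)
  finally have move: "bind_pmf ?\<pi> (\<lambda>\<sigma>. map_pmf (\<lambda>e. exchange e \<sigma>) ?E) = ?\<pi>" by simp
  have either: "bind_pmf ?\<pi> (\<lambda>\<sigma>. if m then map_pmf (\<lambda>e. exchange e \<sigma>) ?E else return_pmf \<sigma>) = ?\<pi>"
    for m
    by (cases m) (simp_all add: move bind_return_pmf')
  have "bind_pmf ?\<pi> (shuffle_step d \<alpha>) = bind_pmf (bernoulli_pmf \<alpha>) (\<lambda>move. bind_pmf ?\<pi> (\<lambda>\<sigma>.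
      if move then map_pmf (\<lambda>e. exchange e \<sigma>) ?E else return_pmf \<sigma>))"
    unfolding shuffle_step_def by (rule bind_commute_pmf)
  then show ?thesis by (simp add: either)
qed

lemma approximate_eigenfunction_imbalance:
  assumes "0 < \<alpha>" "\<alpha> \<le> 1" and small: "4 * \<alpha> / (real d * 2 ^ d) \<le> 1 / 2"
  shows "approximate_eigenfunction (shuffle_step d \<alpha>) S (imbalance d w)
    (4 * \<alpha> / (real d * 2 ^ d)) (16 * \<alpha> / real d)"
proof
  let ?\<Phi> = "imbalance d w" and ?E = "hypercube_edges d"
  fix \<sigma>
  have "measure_pmf.expectation (shuffle_step d \<alpha> \<sigma>) ?\<Phi> =
      ?\<Phi> \<sigma> + \<alpha> * (- 2 * ?\<Phi> \<sigma>) / (real d * 2 ^ d / 2)"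
    using assms dim_pos
    by (simp only: expectation_shuffle_step sum_imbalance_exchange card_hypercube_edges less_imp_le)
  then show "measure_pmf.expectation (shuffle_step d \<alpha> \<sigma>) ?\<Phi> = (1 - 4 * \<alpha> / (real d * 2 ^ d)) * ?\<Phi> \<sigma>"
    by (simp add: left_diff_distrib)
  let ?D = "\<lambda>e. ?\<Phi> (exchange e \<sigma>) - ?\<Phi> \<sigma>"
  \<comment> \<open>The identity a^2 - b^2 = 2 * b * (a - b) + (a - b)^2 reduces the second moment
    to the two sums over edges already evaluated.\<close>
  have "(\<Sum>e\<in>?E. (?\<Phi> (exchange e \<sigma>))\<^sup>2 - (?\<Phi> \<sigma>)\<^sup>2) = (\<Sum>e\<in>?E. 2 * ?\<Phi> \<sigma> * ?D e + (?D e)\<^sup>2)"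
    by (intro sum.cong refl) (simp add: power2_eq_square algebra_simps)
  also have "\<dots> = 2 * ?\<Phi> \<sigma> * (\<Sum>e\<in>?E. ?D e) + (\<Sum>e\<in>?E. (?D e)\<^sup>2)"
    by (simp only: sum.distrib sum_distrib_left)
  also have "\<dots> \<le> 2 * ?\<Phi> \<sigma> * (- 2 * ?\<Phi> \<sigma>) + 8 * 2 ^ d"
    using dim_pos weight by (simp only: sum_imbalance_exchange) (intro add_left_mono sum_imbalance_exchange_square)
  finally have "measure_pmf.expectation (shuffle_step d \<alpha> \<sigma>) (\<lambda>x. (?\<Phi> x)\<^sup>2) \<le>
      (?\<Phi> \<sigma>)\<^sup>2 + \<alpha> * (- 4 * (?\<Phi> \<sigma>)\<^sup>2 + 8 * 2 ^ d) / (real d * 2 ^ d / 2)"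
    using assms dim_pos
    by (subst expectation_shuffle_step)
       (auto simp: card_hypercube_edges power2_eq_square intro!: divide_right_mono mult_left_mono)
  also have "\<dots> = (1 - 2 * (4 * \<alpha> / (real d * 2 ^ d))) * (?\<Phi> \<sigma>)\<^sup>2 + 16 * \<alpha> / real d"
    using dim_pos by (simp add: field_simps)
  finally show "measure_pmf.expectation (shuffle_step d \<alpha> \<sigma>) (\<lambda>x. (?\<Phi> x)\<^sup>2) \<le>
      (1 - 2 * (4 * \<alpha> / (real d * 2 ^ d))) * (?\<Phi> \<sigma>)\<^sup>2 + 16 * \<alpha> / real d" .
qed (use assms dim_pos finite_space shuffle_step_closed in auto)

lemma worst_case_distance_ge:
  assumes \<alpha>: "0 < \<alpha>" "\<alpha> \<le> 1" and small: "4 * \<alpha> / (real d * 2 ^ d) \<le> 1 / 2"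
  shows "worst_case_distance S d \<alpha> t \<ge>
    1 - 16 / ((1 - 4 * \<alpha> / (real d * 2 ^ d)) ^ (2 * t) * 2 ^ d)"
proof -
  let ?\<gamma> = "4 * \<alpha> / (real d * 2 ^ d)"
  interpret approximate_eigenfunction "shuffle_step d \<alpha>" S "imbalance d w" ?\<gamma> "16 * \<alpha> / real d"
    using assms by (rule approximate_eigenfunction_imbalance)
  have top: "imbalance d w \<sigma>\<^sub>0 = 2 ^ d" by (simp add: imbalance_def start side_square)
  have "4 * (16 * \<alpha> / real d) / (?\<gamma> * ((1 - ?\<gamma>) ^ t * imbalance d w \<sigma>\<^sub>0)\<^sup>2) =
      16 / ((1 - ?\<gamma>) ^ (2 * t) * 2 ^ d)"
  proof -
    \<comment> \<open>The ratio of squared increment to rate is 4 * 2^d, free of \<alpha>; dividing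
      by the squared start value 4^d leaves the 2^d in the denominator.\<close>
    have "4 * (16 * \<alpha> / real d) = ?\<gamma> * (16 * 2 ^ d)" using dim_pos by simp
    then have "4 * (16 * \<alpha> / real d) / (?\<gamma> * ((1 - ?\<gamma>) ^ t * 2 ^ d)\<^sup>2) =
        16 * 2 ^ d / ((1 - ?\<gamma>) ^ t * 2 ^ d)\<^sup>2"
      using \<alpha> dim_pos by (simp only: mult.assoc) (rule mult_divide_mult_cancel_left, simp)
    then show ?thesis unfolding top
      by (simp add: power_mult_distrib power2_eq_square mult_2 power_add)
  qed
  moreover have "set_pmf (pmf_of_set S) \<subseteq> S"
    using start(1) finite_space by (subst set_pmf_of_set) auto
  ultimately have "1 - 16 / ((1 - ?\<gamma>) ^ (2 * t) * 2 ^ d) \<le>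
      variation_distance (shuffle_dist d \<alpha> t \<sigma>\<^sub>0) (pmf_of_set S)"
    using wilson_lower_bound[OF start(1) _ _ uniform_stationary, of t] \<alpha>
    unfolding shuffle_dist_def top by simp
  also have "\<dots> \<le> worst_case_distance S d \<alpha> t"
    unfolding worst_case_distance_def using start finite_space by (intro Max_ge) auto
  finally show ?thesis .
qed

end

section \<open>The two state spaces and their extreme starting states\<close>

text \<open>The start has all zeros on the side v 0 = 0 and all ones opposite. Transpositions
  preserve the number of cards of each label.\<close>

lemma binary_arrangement_space:
  assumes "0 < d"
  shows "arrangement_space d (binary_arrangements d) (\<lambda>c. if c = 0 then 1 else - 1)
    (restrict (\<lambda>v. if v 0 = 0 then 0 else 1) (hypercube d))"
proof
  show "finite (binary_arrangements d)"
    by (rule finite_subset[of _ "hypercube d \<rightarrow>\<^sub>E {0, 1}"])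
       (auto simp: binary_arrangements_def intro: finite_PiE)
  show "restrict (\<lambda>v. if v 0 = 0 then 0 else 1) (hypercube d) \<in> binary_arrangements d"
      (is "?\<sigma> \<in> _")
  proof -
    have "{v \<in> hypercube d. ?\<sigma> v = 0} = {v \<in> hypercube d. v 0 = 0}"
      and "{v \<in> hypercube d. ?\<sigma> v = 1} = {v \<in> hypercube d. v 0 \<noteq> 0}" by auto
    then show ?thesis
      using card_hypercube_halves[OF assms] unfolding binary_arrangements_def
      by (simp only: mem_Collect_eq) auto
  qed
next
  fix \<sigma> u v
  assume \<sigma>: "\<sigma> \<in> binary_arrangements d" and uv: "u \<in> hypercube d" "v \<in> hypercube d"
  let ?\<tau> = "Transposition.transpose u v"
  have mem: "?\<tau> x \<in> hypercube d \<longleftrightarrow> x \<in> hypercube d" for x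
    using uv by (auto simp: Transposition.transpose_def)
  have out: "?\<tau> x = x" if "x \<notin> hypercube d" for x
    using uv that by (auto simp: Transposition.transpose_def)
  have "card {x \<in> hypercube d. (\<sigma> \<circ> ?\<tau>) x = c} = card {x \<in> hypercube d. \<sigma> x = c}" for c
    by (intro bij_betw_same_card[of ?\<tau>] bij_betw_byWitness[where f' = ?\<tau>]) (auto simp: mem)
  then show "\<sigma> \<circ> ?\<tau> \<in> binary_arrangements d"
    using \<sigma> mem out by (simp add: binary_arrangements_def PiE_iff extensional_def)
qed (use assms in \<open>auto simp: side_def\<close>)

text \<open>The lower half of the labels gets weight 1 and is placed on the side v 0 = 0. Any
  bijections between the halves will do, and equal cardinalities provide them.\<close>

lemma distinct_arrangement_space:
  assumes "0 < d"
  obtains \<sigma>\<^sub>0 where "arrangement_space d (distinct_arrangements d)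
    (\<lambda>c. if c < 2 ^ (d - 1) then 1 else - 1) \<sigma>\<^sub>0"
proof -
  let ?H = "hypercube d" and ?m = "2 ^ (d - 1) :: nat"
  have d: "2 ^ d = 2 * ?m" using assms by (cases d) auto
  obtain f where f: "bij_betw f {v \<in> ?H. v 0 = 0} {..<?m}"
    using finite_same_card_bij[of "{v \<in> ?H. v 0 = 0}" "{..<?m}"] card_hypercube_halves(1)[OF assms]
    by auto
  obtain g where g: "bij_betw g {v \<in> ?H. v 0 \<noteq> 0} {?m..<2 ^ d}"
    using finite_same_card_bij[of "{v \<in> ?H. v 0 \<noteq> 0}" "{?m..<2 ^ d}"] card_hypercube_halves(2)[OF assms] d
    by auto
  define \<sigma>\<^sub>0 where "\<sigma>\<^sub>0 = restrict (\<lambda>v. if v 0 = 0 then f v else g v) ?H"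
  have "bij_betw \<sigma>\<^sub>0 {v \<in> ?H. v 0 = 0} {..<?m}"
    using f by (rule bij_betw_cong[THEN iffD1, rotated]) (simp add: \<sigma>\<^sub>0_def)
  moreover have "bij_betw \<sigma>\<^sub>0 {v \<in> ?H. v 0 \<noteq> 0} {?m..<2 ^ d}"
    using g by (rule bij_betw_cong[THEN iffD1, rotated]) (simp add: \<sigma>\<^sub>0_def)
  ultimately have "bij_betw \<sigma>\<^sub>0 ({v \<in> ?H. v 0 = 0} \<union> {v \<in> ?H. v 0 \<noteq> 0}) ({..<?m} \<union> {?m..<2 ^ d})"
    by (rule bij_betw_combine) auto
  moreover have "{v \<in> ?H. v 0 = 0} \<union> {v \<in> ?H. v 0 \<noteq> 0} = ?H" by auto
  moreover have "{..<?m} \<union> {?m..<2 ^ d} = {..<2 ^ d}" using d by auto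
  ultimately have bij: "bij_betw \<sigma>\<^sub>0 ?H {..<2 ^ d}" by simp
  have "arrangement_space d (distinct_arrangements d) (\<lambda>c. if c < ?m then 1 else - 1) \<sigma>\<^sub>0"
  proof
    show "finite (distinct_arrangements d)"
    proof (rule finite_subset)
      show "distinct_arrangements d \<subseteq> ?H \<rightarrow>\<^sub>E {..<2 ^ d}"
        by (auto simp: distinct_arrangements_def PiE_def bij_betw_def)
    qed (simp add: finite_PiE)
    show "\<sigma>\<^sub>0 \<in> distinct_arrangements d"
      using bij by (simp add: distinct_arrangements_def) (simp add: \<sigma>\<^sub>0_def)
  next
    fix \<sigma> u v
    assume \<sigma>: "\<sigma> \<in> distinct_arrangements d" and uv: "u \<in> ?H" "v \<in> ?H"
    let ?\<tau> = "Transposition.transpose u v"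
    have mem: "?\<tau> x \<in> ?H \<longleftrightarrow> x \<in> ?H" for x
      using uv by (auto simp: Transposition.transpose_def)
    have out: "?\<tau> x = x" if "x \<notin> ?H" for x
      using uv that by (auto simp: Transposition.transpose_def)
    have "bij_betw ?\<tau> ?H ?H"
      by (rule bij_betw_byWitness[where f' = ?\<tau>]) (auto simp: mem)
    then have "bij_betw (\<sigma> \<circ> ?\<tau>) ?H {..<2 ^ d}"
      by (rule bij_betw_trans) (use \<sigma> in \<open>simp add: distinct_arrangements_def\<close>)
    then show "\<sigma> \<circ> ?\<tau> \<in> distinct_arrangements d"
      using \<sigma> out by (simp add: distinct_arrangements_def extensional_def)
  next
    fix v assume "v \<in> ?H"
    then show "(if \<sigma>\<^sub>0 v < ?m then 1 else - 1) = side v"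
      using bij_betw_apply[OF f, of v] bij_betw_apply[OF g, of v]
      by (cases "v 0 = 0") (auto simp: \<sigma>\<^sub>0_def side_def)
  qed (use assms in auto)
  then show ?thesis by (rule that)
qed

section \<open>The time scale\<close>

text \<open>In logarithms, 2 * t steps of decay cost at most 2 * t * \<gamma> * (1 + 2 * \<gamma>).
  The time bound limits 2 * t * \<gamma> to (1 - \<delta>) * d * ln 2, and 1 + 2 * \<gamma> \<le> 1
  + \<delta> for large \<open>d\<close>. The product (1 - \<delta>) * (1 + \<delta>) leaves the
  margin \<delta>^2 * d * ln 2 out of ln (2^d).\<close>

lemma decay_ge:
  fixes \<alpha> \<delta> :: real
  assumes "0 < d" "0 < \<alpha>" "\<alpha> \<le> 1" "0 < \<delta>" "\<delta> < 1"
    and d: "8 / \<delta> \<le> real d"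
    and t: "real t \<le> (1 - \<delta>) * (ln 2 / (8 * \<alpha>)) * (real d)\<^sup>2 * 2 ^ d"
  shows "4 * \<alpha> / (real d * 2 ^ d) \<le> 1 / 2"
    and "(1 - 4 * \<alpha> / (real d * 2 ^ d)) ^ (2 * t) * 2 ^ d \<ge> exp (\<delta>\<^sup>2 * ln 2 * real d)"
proof -
  define \<gamma> where "\<gamma> = 4 * \<alpha> / (real d * 2 ^ d)"
  \<comment> \<open>The crude bound 2^d \<ge> 1 is enough here; with d \<ge> 8 / \<delta> it yields
    2 * \<gamma> \<le> \<delta>.\<close>
  have "\<gamma> \<le> 4 * 1 / (real d * 1)"
    unfolding \<gamma>_def using assms by (intro frac_le mult_left_mono mult_pos_pos) auto
  also have "\<dots> \<le> \<delta> / 2" using d assms by (simp add: field_simps)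
  finally have \<gamma>: "2 * \<gamma> \<le> \<delta>" "0 \<le> \<gamma>" using assms by (auto simp: \<gamma>_def)
  then have half: "\<gamma> \<le> 1 / 2" using assms by simp
  then show "4 * \<alpha> / (real d * 2 ^ d) \<le> 1 / 2" by (simp add: \<gamma>_def)
  have "2 * real t * \<gamma> \<le> 2 * ((1 - \<delta>) * (ln 2 / (8 * \<alpha>)) * (real d)\<^sup>2 * 2 ^ d) * \<gamma>"
    using t \<gamma> by (intro mult_right_mono mult_left_mono) auto
  also have "\<dots> = (1 - \<delta>) * (ln 2 * real d)"
    using assms by (simp add: \<gamma>_def field_simps power2_eq_square)
  finally have total: "2 * real t * \<gamma> \<le> (1 - \<delta>) * (ln 2 * real d)" .
  have "2 * real t * \<gamma> * (1 + 2 * \<gamma>) \<le> (1 - \<delta>) * (ln 2 * real d) * (1 + \<delta>)"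
    by (rule mult_mono[OF total]) (use \<gamma> assms in auto)
  also have "\<dots> = ln 2 * real d - \<delta>\<^sup>2 * ln 2 * real d"
    by (simp add: algebra_simps power2_eq_square)
  finally have "\<delta>\<^sup>2 * ln 2 * real d \<le> 2 * real t * (- \<gamma> - 2 * \<gamma>\<^sup>2) + ln 2 * real d"
    by (simp add: algebra_simps power2_eq_square)
  \<comment> \<open>Here ln (1 - \<gamma>) \<ge> - \<gamma> - 2 * \<gamma>^2, valid for 0 \<le>
    \<gamma> \<le> 1/2.\<close>
  also have "\<dots> \<le> 2 * real t * ln (1 - \<gamma>) + ln 2 * real d"
    using ln_one_minus_pos_lower_bound[OF \<gamma>(2) half] by (intro add_right_mono mult_left_mono) auto
  finally have "exp (\<delta>\<^sup>2 * ln 2 * real d) \<le> exp (real (2 * t) * ln (1 - \<gamma>) + real d * ln 2)"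
    by (simp add: mult.commute)
  also have "\<dots> = (1 - \<gamma>) ^ (2 * t) * 2 ^ d"
    using half by (simp only: exp_add exp_of_nat_mult) simp
  finally show "exp (\<delta>\<^sup>2 * ln 2 * real d) \<le> (1 - 4 * \<alpha> / (real d * 2 ^ d)) ^ (2 * t) * 2 ^ d"
    by (simp add: \<gamma>_def)
qed

theorem mainTheorem11:
  fixes \<epsilon> \<delta> :: real
  assumes "0 < \<epsilon>" "\<epsilon> < 1" "0 < \<delta>" "\<delta> < 1"
  shows "\<exists>D::nat. \<forall>d\<ge>D. \<forall>\<alpha>::real. \<forall>t::nat.
    0 < \<alpha> \<longrightarrow> \<alpha> \<le> 1 \<longrightarrow>
    real t \<le> (1 - \<delta>) * (ln 2 / (8 * \<alpha>)) * (real d)\<^sup>2 * 2 ^ d \<longrightarrow>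
      worst_case_distance (distinct_arrangements d) d \<alpha> t \<ge> 1 - \<epsilon> \<and>
      worst_case_distance (binary_arrangements d) d \<alpha> t \<ge> 1 - \<epsilon>"
proof -
  \<comment> \<open>The first term is what \<open>decay_ge\<close> asks for and also forces d > 0.
    The second makes \<delta>^2 * ln 2 * d at least 16 / \<epsilon>, and exp y \<ge> y carries this
    over to \<open>X\<close> below. Neither involves \<alpha> or \<open>t\<close>.\<close>
  define D where "D = nat \<lceil>max (8 / \<delta>) (16 / \<epsilon> / (\<delta>\<^sup>2 * ln 2))\<rceil>"
  show ?thesis
  proof (intro exI[of _ D] allI impI)
    fix d t :: nat and \<alpha> :: real
    assume "D \<le> d" and \<alpha>: "0 < \<alpha>" "\<alpha> \<le> 1"
      and t: "real t \<le> (1 - \<delta>) * (ln 2 / (8 * \<alpha>)) * (real d)\<^sup>2 * 2 ^ d"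
    then have d: "8 / \<delta> \<le> real d" "16 / \<epsilon> / (\<delta>\<^sup>2 * ln 2) \<le> real d"
      unfolding D_def by linarith+
    have "0 < 8 / \<delta>" using assms by simp
    with d have pos: "0 < d" by linarith
    define X where "X = (1 - 4 * \<alpha> / (real d * 2 ^ d)) ^ (2 * t) * 2 ^ d"
    note decay = decay_ge[OF pos \<alpha> assms(3,4) d(1) t, folded X_def]
    have "16 / \<epsilon> \<le> \<delta>\<^sup>2 * ln 2 * real d" using d(2) assms by (simp add: field_simps)
    also have "\<dots> \<le> exp (\<delta>\<^sup>2 * ln 2 * real d)"
      using exp_ge_add_one_self[of "\<delta>\<^sup>2 * ln 2 * real d"] by linarith
    also note decay(2)
    finally have "16 / \<epsilon> \<le> X" .
    moreover have "0 < X" by (rule less_le_trans[OF exp_gt_zero decay(2)])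
    ultimately have "16 / X \<le> \<epsilon>" using assms(1) by (simp add: field_simps)
    then have bound: "1 - \<epsilon> \<le> worst_case_distance S d \<alpha> t"
      if "arrangement_space d S w \<sigma>\<^sub>0" for S w \<sigma>\<^sub>0
      using arrangement_space.worst_case_distance_ge[OF that \<alpha> decay(1), of t, folded X_def] by simp
    obtain \<sigma>\<^sub>0 where "arrangement_space d (distinct_arrangements d)
        (\<lambda>c. if c < 2 ^ (d - 1) then 1 else - 1) \<sigma>\<^sub>0"
      using distinct_arrangement_space[OF pos] .
    then show "worst_case_distance (distinct_arrangements d) d \<alpha> t \<ge> 1 - \<epsilon> \<and>
        worst_case_distance (binary_arrangements d) d \<alpha> t \<ge> 1 - \<epsilon>"
      using bound binary_arrangement_space[OF pos] by blast
  qed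
qed

end
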